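(* Consider the portfolio algorithm NOPA (described in the context) with $M=2$ solvers, non-decreasing integer sequences $(r_n)_{n\in\mathbb N^*}$ and $(s_n)_{n\in\mathbb N^*}$, and without lag, i.e. $\mathrm{lag}(r_n)=r_n$ for all $n\in\mathbb N^*$. Assume that: (a) the noise is standard normal $\mathcal N(0,1)$; (b) almost surely, for $i\in\{1,2\}$, $SR_{i,m}=(1+o(1))\frac{C_i}{m^{\alpha_i}}$ after $m\in\mathbb N^*$ evaluations, with positive constants $C_1,C_2$, $\alpha_1=1-e$ and $\alpha_2=1-2e$, where $e\in(0,0.5)$ is a constant; (c) $s_n=O(r_n^{\beta})$ with $\beta\le 2-4e$. Then, almost surely, the portfolio selects the wrong solver infinitely often.
   Context: $\mathbb N^*=\{1,2,3,\dots\}$. The objective is a noisy function $f$ on a domain $\mathcal D\subset\mathbb R^d$ with additive unbiased noise: each call at $x$ returns $f(x,\omega)=\mathbb E_\omega[f(x,\omega)]+\omega$, where $\omega$ is sampled independently at each call. The goal is to minimize $x\mapsto \mathbb E_\omega f(x,\omega)$, whose minimizer is $x^*$. For $s\in\mathbb N^*$, $\hat{\mathbb E}_s[f(x)]$ is the average of $s$ independent evaluations of $f$ at $x$ (using fresh noise). $\tilde x_{i,n}\in\mathcal D$ is the (random) point recommended by solver $i\in\{1,\dots,M\}$ after it has spent $n$ function evaluations. Its simple regret is $SR_{i,n}=\mathbb E_\omega\left(f(\tilde x_{i,n},\omega)-f(x^*,\omega)\right)$, where the expectation is only over the fresh noise $\omega$, so that $SR_{i,n}$ is a random variable depending on $\tilde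 x_{i,n}$. NOPA (Noisy Optimization Portfolio Algorithm) with lag function $\mathrm{lag}:\mathbb N^*\to\mathbb N^*$: at each iteration every solver receives one evaluation, so at iteration $r_n$ each solver has spent $r_n$ evaluations. At iteration $r_n$ the $n$-th selection is made: $s_n$ fresh independent evaluations are spent at each of the points $\tilde x_{i,\mathrm{lag}(r_n)}$, $i=1,\dots,M$, and the selected solver is $i^*\in\arg\min_{i\in\{1,\dots,M\}}\hat{\mathbb E}_{s_n}[f(\tilde x_{i,\mathrm{lag}(r_n)})]$. The wrong solver is selected at the $n$-th selection if the selected solver does not have the smallest simple regret after $r_n$ evaluations (so, for $n$ large, if solver $2$ is selected). *)

theory Defs
  imports "HOL-Probability.Probability" "HOL-Library.Landau_Symbols"
begin

definition expected_objective :: "real measure \<Rightarrow> ('a \<Rightarrow> real \<Rightarrow> real) \<Rightarrow> 'a \<Rightarrow> real" where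
  "expected_objective N f y = (LINT w|N. f y w)"

text \<open>The integral is only over the fresh noise, so the regret is still a function of the
  outcome \<open>\<omega>\<close> that determines the recommended point \<open>x i m \<omega>\<close>.\<close>

definition simple_regret ::
  "real measure \<Rightarrow> ('a \<Rightarrow> real \<Rightarrow> real) \<Rightarrow> 'a \<Rightarrow> (nat \<Rightarrow> nat \<Rightarrow> 'w \<Rightarrow> 'a) \<Rightarrow> nat \<Rightarrow> nat \<Rightarrow> 'w \<Rightarrow> real" where
  "simple_regret N f xstar x i m \<omega> = (LINT w|N. f (x i m \<omega>) w - f xstar w)"

definition empirical_mean :: "('a \<Rightarrow> real \<Rightarrow> real) \<Rightarrow> 'a \<Rightarrow> nat \<Rightarrow> (nat \<Rightarrow> real) \<Rightarrow> real" where
  "empirical_mean f y k w = (\<Sum>j=1..k. f y (w j)) / real k"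

text \<open>A solver that ties for the smallest regret is not a wrong choice. So if \<open>r\<close> stays bounded
  and the two regrets happen to be equal there, no selection is wrong; when \<open>r\<close> tends to
  infinity such ties disappear eventually and the wrong choice is the asymptotically worse solver.\<close>

definition wrong_selection ::
  "real measure \<Rightarrow> ('a \<Rightarrow> real \<Rightarrow> real) \<Rightarrow> 'a \<Rightarrow> (nat \<Rightarrow> nat \<Rightarrow> 'w \<Rightarrow> 'a) \<Rightarrow> nat \<Rightarrow> (nat \<Rightarrow> nat)
    \<Rightarrow> (nat \<Rightarrow> 'w \<Rightarrow> nat) \<Rightarrow> nat \<Rightarrow> 'w \<Rightarrow> bool" where
  "wrong_selection N f xstar x M r sel n \<omega> \<longleftrightarrow>
     \<not> (\<forall>j\<in>{1..M}. simple_regret N f xstar x (sel n \<omega>) (r n) \<omega> \<le> simple_regret N f xstar x j (r n) \<omega>)"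

definition solver_index :: "nat \<Rightarrow> (nat \<times> nat) set" where
  "solver_index M = {1..M} \<times> {1..}"

definition selection_index :: "nat \<Rightarrow> (nat \<Rightarrow> nat) \<Rightarrow> (nat \<times> nat \<times> nat) set" where
  "selection_index M s = {(n, i, k). 1 \<le> n \<and> i \<in> {1..M} \<and> k \<in> {1..s n}}"

text \<open>The solvers enter only through their recommendations \<open>x i m\<close> (solver \<open>i\<close> after \<open>m\<close>
  evaluations), an arbitrary random process. \<open>noise n i k\<close> is the noise of the \<open>k\<close>-th of the \<open>s n\<close>
  evaluations of solver \<open>i\<close>'s point at the \<open>n\<close>-th selection. These evaluations are fresh and are
  not fed back to the solvers, so the noises are independent of each other and of the
  recommendation process. The sequences are indexed from 1; their values at 0 are irrelevant.
  Nothing is assumed on how \<open>sel\<close> breaks ties.\<close>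

locale nopa = prob_space P for P :: "'w measure" +
  fixes D :: "(real ^ 'd) set"
    and N :: "real measure"
    and f :: "real ^ 'd \<Rightarrow> real \<Rightarrow> real"
    and xstar :: "real ^ 'd"
    and M :: nat
    and lag r s :: "nat \<Rightarrow> nat"
    and x :: "nat \<Rightarrow> nat \<Rightarrow> 'w \<Rightarrow> real ^ 'd"
    and noise :: "nat \<Rightarrow> nat \<Rightarrow> nat \<Rightarrow> 'w \<Rightarrow> real"
    and sel :: "nat \<Rightarrow> 'w \<Rightarrow> nat"
  assumes noise_law: "prob_space N" "sets N = sets borel" "integrable N (\<lambda>w. w)" "(LINT w|N. w) = 0"
    and additive: "\<And>y w. y \<in> D \<Longrightarrow> f y w = expected_objective N f y + w"
    and objective_measurable: "expected_objective N f \<in> borel_measurable (restrict_space borel D)"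
    and minimizer: "xstar \<in> D" "\<And>y. y \<in> D \<Longrightarrow> expected_objective N f xstar \<le> expected_objective N f y"
    and lag_pos: "\<And>m. 1 \<le> m \<Longrightarrow> 1 \<le> lag m"
    and r_pos: "\<And>n. 1 \<le> n \<Longrightarrow> 1 \<le> r n" and r_mono: "mono_on {1..} r"
    and s_pos: "\<And>n. 1 \<le> n \<Longrightarrow> 1 \<le> s n" and s_mono: "mono_on {1..} s"
    and recommendation: "\<And>i m. i \<in> {1..M} \<Longrightarrow> 1 \<le> m \<Longrightarrow> x i m \<in> measurable P (restrict_space borel D)"
    and noise_distr: "\<And>n i k. (n, i, k) \<in> selection_index M s \<Longrightarrow> distr P borel (noise n i k) = N"
    and noise_indep: "indep_vars (\<lambda>_. borel) (\<lambda>(n, i, k). noise n i k) (selection_index M s)"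
    and noise_fresh: "indep_set
          (sets (vimage_algebra (space P) (\<lambda>\<omega>. restrict (\<lambda>(i, m). x i m \<omega>) (solver_index M))
            (PiM (solver_index M) (\<lambda>_. restrict_space borel D))))
          (sets (vimage_algebra (space P) (\<lambda>\<omega>. restrict (\<lambda>(n, i, k). noise n i k \<omega>) (selection_index M s))
            (PiM (selection_index M s) (\<lambda>_. borel))))"
    and selection: "\<And>n \<omega>. 1 \<le> n \<Longrightarrow> \<omega> \<in> space P \<Longrightarrow>
          is_arg_min (\<lambda>i. empirical_mean f (x i (lag (r n)) \<omega>) (s n) (\<lambda>k. noise n i k \<omega>))
            (\<lambda>i. i \<in> {1..M}) (sel n \<omega>)"

end

theory Submission
  imports Defs
begin

text \<open>Along the selection times the regret of solver 2 is at most of order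
  \<open>r\<^sub>n powr (2 * e - 1)\<close>, while the difference of the two averaged noises is a centred normal variable of
  standard deviation \<open>sqrt (2 / s\<^sub>n)\<close>, which by the bound on \<open>s\<^sub>n\<close> is at least of that same order.
  So the standardised regret gap stays below some level, which depends on the outcome, and by the
  second Borel-Cantelli lemma the independent standardised noise differences almost surely exceed
  every integer level infinitely often.\<close>

section \<open>Second Borel-Cantelli lemma and sums of independent normal variables\<close>

text \<open>By the Borel zero-one law, failure would mean that almost surely only finitely many
  \<open>Q n\<close> occur. The decreasing events \<open>B n\<close>, that some \<open>Q m\<close>
  with \<open>m \<ge> n\<close> occurs, would then shrink to a null set, although each has
  probability at least \<open>p\<close>.\<close>

lemma (in prob_space) borel_cantelli_indep_AE:
  fixes Q :: "nat \<Rightarrow> 'a \<Rightarrow> bool"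
  assumes indep: "indep_events (\<lambda>n. {\<omega>\<in>space M. Q n \<omega>}) UNIV"
    and p: "0 < p" "\<And>n. p \<le> prob {\<omega>\<in>space M. Q n \<omega>}"
  shows "AE \<omega> in M. infinite {n. Q n \<omega>}"
proof (rule ccontr)
  assume "\<not> ?thesis"
  then have fin: "AE \<omega> in M. finite {n. Q n \<omega>}"
    using borel_0_1_law_AE[OF indep] by blast
  have [measurable]: "{\<omega>\<in>space M. Q n \<omega>} \<in> events" for n
    using indep by (auto simp: indep_events_def)
  define B where "B = (\<lambda>n. {\<omega>\<in>space M. \<exists>m\<in>{n..}. Q m \<omega>})"
  have B: "B n \<in> events" for n
    unfolding B_def by measurable
  have "(\<lambda>n. prob (B n)) \<longlonglongrightarrow> prob (\<Inter>n. B n)"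
    using B by (intro finite_Lim_measure_decseq) (auto simp: B_def decseq_def intro: order_trans)
  moreover have "prob (\<Inter>n. B n) = 0"
  proof -
    have "AE \<omega> in M. \<omega> \<notin> (\<Inter>n. B n)"
      using fin
    proof eventually_elim
      case (elim \<omega>)
      then obtain k where "\<forall>n\<in>{n. Q n \<omega>}. n < k"
        using finite_nat_set_iff_bounded by blast
      then have "\<omega> \<notin> B k"
        by (force simp: B_def)
      then show ?case by blast
    qed
    then show ?thesis
      using B by (subst prob_eq_0) auto
  qed
  ultimately have "(\<lambda>n. prob (B n)) \<longlonglongrightarrow> 0"
    by simp
  moreover have "p \<le> prob (B n)" for n
    using p(2)[of n] finite_measure_mono[of "{\<omega>\<in>space M. Q n \<omega>}" "B n"] B[of n]
    by (force simp: B_def)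
  ultimately have "p \<le> 0"
    by (intro LIMSEQ_le_const) auto
  with p(1) show False by simp
qed

text \<open>The density is positive everywhere, so a tail of measure zero would also be a Lebesgue
  null set; but it contains an interval of length one.\<close>

lemma std_normal_tail_pos:
  fixes a :: real
  shows "0 < measure std_normal_distribution {a<..}"
proof -
  interpret N: prob_space std_normal_distribution
    by (rule prob_space_normal_density) simp
  have "emeasure std_normal_distribution {a<..} \<noteq> 0"
  proof
    assume "emeasure std_normal_distribution {a<..} = 0"
    then have "AE x in lborel. x \<notin> {a<..}"
      by (auto simp: emeasure_density nn_integral_0_iff_AE normal_density_def
          split: split_indicator_asm elim!: eventually_mono)
    then have "emeasure lborel {a<..} = 0"
      by (subst (asm) AE_iff_measurable[OF _ refl]) (auto simp: greaterThan_def)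
    moreover have "emeasure lborel {a<..<a+1} \<le> emeasure lborel {a<..}"
      by (intro emeasure_mono) auto
    ultimately show False by simp
  qed
  then show ?thesis
    by (simp add: N.emeasure_eq_measure zero_less_measure_iff)
qed

text \<open>A sign change preserves the standard normal law and variances add, so each block sum
  divided by \<open>sqrt (card (K n))\<close> is again standard normal. The probability of exceeding
  the scaled level is thus the same positive number for every block, whatever its size. The signs
  \<open>c\<close> allow a difference of two noise sums to be treated as one block.\<close>

lemma (in prob_space) AE_infinite_normal_block_exceed:
  fixes X :: "'i \<Rightarrow> 'a \<Rightarrow> real" and K :: "nat \<Rightarrow> 'i set" and c :: "'i \<Rightarrow> real"
  assumes indep: "indep_vars (\<lambda>_. borel) X I"
    and law: "\<And>i. i \<in> I \<Longrightarrow> distr M borel (X i) = std_normal_distribution"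
    and K: "\<And>n. finite (K n)" "\<And>n. K n \<noteq> {}" "\<And>n. K n \<subseteq> I" "disjoint_family K"
    and c: "\<And>i. \<bar>c i\<bar> = 1"
  shows "AE \<omega> in M. infinite {n. a * sqrt (card (K n)) < (\<Sum>i\<in>K n. c i * X i \<omega>)}"
proof -
  define S where "S = (\<lambda>n \<omega>. \<Sum>i\<in>K n. c i * X i \<omega>)"
  have X[measurable]: "random_variable borel (X i)" if "i \<in> I" for i
    using indep that by (auto simp: indep_vars_def)
  have normal: "distributed M lborel (\<lambda>\<omega>. c i * X i \<omega>) (normal_density 0 1)" if "i \<in> I" for i
  proof -
    have "distr M lborel (X i) = std_normal_distribution"
      using law[OF that] by (simp cong: distr_cong)
    then have "distributed M lborel (X i) (normal_density 0 1)"
      using X[OF that] by (simp add: distributed_def)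
    from normal_density_affine[OF this, of "c i" 0] c[of i] show ?thesis by force
  qed
  have S_law: "distributed M lborel (\<lambda>\<omega>. S n \<omega> / sqrt (card (K n))) std_normal_density" for n
  proof -
    have "indep_vars (\<lambda>_. borel) (\<lambda>i \<omega>. c i * X i \<omega>) (K n)"
      by (rule indep_vars_compose2[OF indep_vars_subset[OF indep K(3)]]) auto
    then have "distributed M lborel (S n) (normal_density (\<Sum>i\<in>K n. 0) (sqrt (\<Sum>i\<in>K n. 1\<^sup>2)))"
      unfolding S_def using K(1,2) K(3)[of n] normal by (intro sum_indep_normal) auto
    moreover have "0 < sqrt (card (K n))"
      using K(1,2)[of n] by (simp add: card_gt_0_iff)
    ultimately show ?thesis
      using normal_standard_normal_convert[of "sqrt (card (K n))" "S n" 0] by simp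
  qed
  have S_prob: "prob {\<omega>\<in>space M. a * sqrt (card (K n)) < S n \<omega>} = measure std_normal_distribution {a<..}" for n
  proof -
    let ?T = "\<lambda>\<omega>. S n \<omega> / sqrt (card (K n))"
    have "0 < sqrt (card (K n))"
      using K(1,2)[of n] by (simp add: card_gt_0_iff)
    then have "{\<omega>\<in>space M. a * sqrt (card (K n)) < S n \<omega>} = ?T -` {a<..} \<inter> space M"
      by (auto simp: pos_less_divide_eq)
    moreover have "measure (distr M lborel ?T) {a<..} = prob (?T -` {a<..} \<inter> space M)"
      using S_law[of n] by (intro measure_distr) (auto simp: distributed_def)
    ultimately show ?thesis
      using S_law[of n] by (simp add: distributed_def)
  qed
  \<comment> \<open>Disjoint blocks of an independent family are independent as vectors, and each
    block sum is a measurable function of its own vector.\<close>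
  have "indep_vars (\<lambda>n. PiM (K n) (\<lambda>_. borel)) (\<lambda>n \<omega>. restrict (\<lambda>i. X i \<omega>) (K n)) UNIV"
    by (rule indep_vars_restrict[OF indep]) (use K in auto)
  then have "indep_vars (\<lambda>_. borel)
      (\<lambda>n \<omega>. (\<lambda>v. \<Sum>i\<in>K n. c i * v i) (restrict (\<lambda>i. X i \<omega>) (K n))) UNIV"
    by (rule indep_vars_compose2) measurable
  then have "indep_vars (\<lambda>_. borel) S UNIV"
    by (rule indep_vars_cong[THEN iffD1, rotated -1]) (auto simp: S_def)
  then have "indep_events (\<lambda>n. {\<omega>\<in>space M. a * sqrt (card (K n)) < S n \<omega>}) UNIV"
    by (rule indep_eventsI_indep_vars) auto
  then have "AE \<omega> in M. infinite {n. a * sqrt (card (K n)) < S n \<omega>}"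
    by (rule borel_cantelli_indep_AE[OF _ std_normal_tail_pos[of a]]) (simp only: S_prob order_refl)
  then show ?thesis
    by (simp only: S_def)
qed

section \<open>Power-law asymptotics\<close>

text \<open>An eventual bound becomes a bound for all \<open>m\<close> by enlarging the constant to
  cover finitely many exceptions. It can therefore be evaluated at \<open>m = r n\<close> even if
  \<open>r\<close> stays bounded.\<close>

lemma asymp_equiv_powr_imp_bounded:
  fixes g :: "nat \<Rightarrow> real"
  assumes "g \<sim>[at_top] (\<lambda>m. C / real m powr p)"
  obtains B where "\<And>m. \<bar>g m\<bar> * real m powr p \<le> B"
proof -
  from asymp_equiv_imp_bigo[OF assms] obtain c
    where "eventually (\<lambda>m. norm (g m) \<le> c * norm (C / real m powr p)) at_top"
    by (rule landau_o.bigE)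
  then have "eventually (\<lambda>m. norm (g m * real m powr p) \<le> norm (c * \<bar>C\<bar>)) sequentially"
    using eventually_gt_at_top[of 0]
  proof eventually_elim
    case (elim m)
    then have "\<bar>g m\<bar> * real m powr p \<le> c * \<bar>C\<bar>"
      by (simp add: field_simps)
    then show ?case
      by (simp add: abs_mult order_trans[OF _ mult_right_mono[OF abs_ge_self[of c] abs_ge_zero[of C]]])
  qed
  then have "Bseq (\<lambda>m. g m * real m powr p)"
    by (rule Bseq_eventually_mono) simp
  then obtain B where "\<And>m. norm (g m * real m powr p) \<le> B"
    by (rule BseqE) blast
  then show thesis
    using that[of B] by (simp add: abs_mult)
qed

text \<open>After multiplication by \<open>m powr q\<close>, the left side is at most a constant
  times \<open>m powr (q - p)\<close>, which tends to 0, while the right side tends to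
  \<open>C2 > 0\<close>; the value \<open>C2 / 2\<close> separates them. This is what makes solver 1
  eventually the better one.\<close>

lemma eventually_powr_asymp_less:
  fixes g h :: "nat \<Rightarrow> real"
  assumes g: "g \<sim>[at_top] (\<lambda>m. C1 / real m powr p)" and h: "h \<sim>[at_top] (\<lambda>m. C2 / real m powr q)"
    and C: "0 < C2" and pq: "q < p"
  shows "eventually (\<lambda>m. g m < h m) at_top"
proof -
  obtain B where B: "\<And>m. \<bar>g m\<bar> * real m powr p \<le> B"
    using asymp_equiv_powr_imp_bounded[OF g] by blast
  have "((\<lambda>m. real m powr (q - p)) \<longlongrightarrow> 0) at_top"
    using pq by (intro tendsto_neg_powr filterlim_real_sequentially) auto
  then have "((\<lambda>m. B * real m powr (q - p)) \<longlongrightarrow> 0) at_top"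
    by (rule tendsto_mult_right_zero)
  then have "eventually (\<lambda>m. B * real m powr (q - p) < C2 / 2) at_top"
    using C by (intro order_tendstoD) auto
  moreover have "eventually (\<lambda>m. C2 / 2 < h m * real m powr q) at_top"
  proof -
    have "(\<lambda>m. h m * real m powr q) \<sim>[at_top] (\<lambda>m. C2 / real m powr q * real m powr q)"
      by (intro asymp_equiv_intros h)
    also have "(\<lambda>m. C2 / real m powr q * real m powr q) \<sim>[at_top] (\<lambda>_. C2)"
      by (intro asymp_equiv_refl_ev eventually_mono[OF eventually_gt_at_top[of 0]]) auto
    finally have "((\<lambda>m. h m * real m powr q) \<longlongrightarrow> C2) at_top"
      by (rule asymp_equivD_const)
    then show ?thesis
      using C by (intro order_tendstoD) auto
  qed
  ultimately show ?thesis
    using eventually_gt_at_top[of 0]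
  proof eventually_elim
    case (elim m)
    have "g m * real m powr q = g m * real m powr p * real m powr (q - p)"
      using elim by (simp add: powr_diff)
    also have "\<dots> \<le> B * real m powr (q - p)"
      using B[of m] abs_ge_self[of "g m * real m powr p"]
      by (intro mult_right_mono) (auto simp: abs_mult)
    also have "\<dots> < h m * real m powr q"
      using elim by simp
    finally show ?case
      using elim by simp
  qed
qed

section \<open>Regrets, selections and noises of the algorithm\<close>

context nopa
begin

lemma recommendation_in_domain:
  assumes "i \<in> {1..M}" "1 \<le> m" "\<omega> \<in> space P"
  shows "x i m \<omega> \<in> D"
  using measurable_space[OF recommendation[OF assms(1,2)] assms(3)] by (simp add: space_restrict_space)

text \<open>The additive noise cancels in the difference, so the integrand is constant in
  \<open>w\<close>.\<close>

lemma simple_regret_eq: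
  assumes "x i m \<omega> \<in> D"
  shows "simple_regret N f xstar x i m \<omega>
    = expected_objective N f (x i m \<omega>) - expected_objective N f xstar"
proof -
  interpret N: prob_space N by (rule noise_law)
  have "f (x i m \<omega>) w - f xstar w
      = expected_objective N f (x i m \<omega>) - expected_objective N f xstar" for w
    using additive[OF assms, of w] additive[OF minimizer(1), of w] by simp
  then show ?thesis
    by (simp add: simple_regret_def N.prob_space)
qed

lemma empirical_mean_eq:
  assumes "y \<in> D" "1 \<le> k"
  shows "empirical_mean f y k w = expected_objective N f y + (\<Sum>j=1..k. w j) / real k"
proof -
  have "(\<Sum>j=1..k. f y (w j)) = real k * expected_objective N f y + (\<Sum>j=1..k. w j)"
    using additive[OF assms(1)] by (simp add: sum.distrib)
  then show ?thesis
    using assms(2) by (simp add: empirical_mean_def field_simps)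
qed

text \<open>Choosing solver 1 would bound the noise difference by \<open>s n\<close> times the gap
  between the two expected values. That gap is at most the regret of solver 2, since
  \<open>xstar\<close> is a minimizer. The strict inequality excludes a tie, so the tie-breaking
  rule does not matter.\<close>

lemma selects_second:
  assumes M: "M = 2" and lag: "lag (r n) = r n" and n: "1 \<le> n" and \<omega>: "\<omega> \<in> space P"
    and exceed: "real (s n) * simple_regret N f xstar x 2 (r n) \<omega>
      < (\<Sum>k=1..s n. noise n 1 k \<omega>) - (\<Sum>k=1..s n. noise n 2 k \<omega>)"
  shows "sel n \<omega> = 2"
proof (rule ccontr)
  assume "sel n \<omega> \<noteq> 2"
  then have sel: "sel n \<omega> = 1"
    using selection[OF n \<omega>] M by (auto simp: is_arg_min_def)
  have D: "x 1 (r n) \<omega> \<in> D" "x 2 (r n) \<omega> \<in> D"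
    using recommendation_in_domain[OF _ r_pos[OF n] \<omega>] M by auto
  have s: "0 < real (s n)"
    using s_pos[OF n] by simp
  let ?g = "\<lambda>i. expected_objective N f (x i (r n) \<omega>)"
  have "empirical_mean f (x 1 (r n) \<omega>) (s n) (\<lambda>k. noise n 1 k \<omega>)
      \<le> empirical_mean f (x 2 (r n) \<omega>) (s n) (\<lambda>k. noise n 2 k \<omega>)"
    using selection[OF n \<omega>] sel M lag by (fastforce simp: is_arg_min_def not_less)
  then have "(\<Sum>k=1..s n. noise n 1 k \<omega>) - (\<Sum>k=1..s n. noise n 2 k \<omega>) \<le> real (s n) * (?g 2 - ?g 1)"
    using s unfolding empirical_mean_eq[OF D(1) s_pos[OF n]] empirical_mean_eq[OF D(2) s_pos[OF n]]
    by (subst mult.commute, subst pos_divide_le_eq[symmetric]) (simp_all add: diff_divide_distrib)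
  also have "\<dots> \<le> real (s n) * simple_regret N f xstar x 2 (r n) \<omega>"
    using s minimizer(2)[OF D(1)] by (simp add: simple_regret_eq D)
  finally show False
    using exceed by simp
qed

lemma AE_infinite_noise_exceed:
  assumes M: "M = 2" and N: "N = std_normal_distribution"
  shows "AE \<omega> in P. infinite {n. 1 \<le> n \<and> a * sqrt (2 * real (s n))
      < (\<Sum>k=1..s n. noise n 1 k \<omega>) - (\<Sum>k=1..s n. noise n 2 k \<omega>)}"
proof -
  \<comment> \<open>One block collects all \<open>2 * s n\<close> noises of a selection. The shift
    by \<open>Suc\<close> reconciles blocks counted from 0 with selections counted from 1; it is
    undone below by taking the image under \<open>Suc\<close>.\<close>
  define K where "K = (\<lambda>n. {Suc n} \<times> {1, 2::nat} \<times> {1..s (Suc n)})"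
  \<comment> \<open>These signs turn the block sum into the noise of solver 1 minus that of solver
    2.\<close>
  define c :: "nat \<times> nat \<times> nat \<Rightarrow> real" where "c = (\<lambda>(n, i, k). if i = 1 then 1 else - 1)"
  have "AE \<omega> in P. infinite {n. a * sqrt (card (K n))
      < (\<Sum>t\<in>K n. c t * (\<lambda>(n, i, k). noise n i k) t \<omega>)}"
  proof (rule AE_infinite_normal_block_exceed[OF noise_indep])
    show "distr P borel ((\<lambda>(n, i, k). noise n i k) t) = std_normal_distribution"
      if "t \<in> selection_index M s" for t
      using that noise_distr N by (cases t) auto
    show "K n \<noteq> {}" for n
      using s_pos[of "Suc n"] by (auto simp: K_def)
    show "disjoint_family K"
      by (auto simp: disjoint_family_on_def K_def)
  qed (auto simp: K_def c_def M selection_index_def)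
  then show ?thesis
  proof eventually_elim
    case (elim \<omega>)
    have "card (K n) = 2 * s (Suc n)" for n
      by (simp add: K_def card_cartesian_product)
    moreover have "(\<Sum>t\<in>K n. c t * (\<lambda>(n, i, k). noise n i k) t \<omega>)
        = (\<Sum>k=1..s (Suc n). noise (Suc n) 1 k \<omega>) - (\<Sum>k=1..s (Suc n). noise (Suc n) 2 k \<omega>)" for n
      by (simp add: K_def c_def sum.cartesian_product' sum_negf case_prod_unfold)
    ultimately have "infinite {n. a * sqrt (2 * real (s (Suc n))) < (\<Sum>k=1..s (Suc n). noise (Suc n) 1 k \<omega>)
        - (\<Sum>k=1..s (Suc n). noise (Suc n) 2 k \<omega>)}" (is "infinite ?S")
      using elim by simp
    then have "infinite (Suc ` ?S)"
      by (simp add: finite_image_iff)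
    then show ?case
      by (rule infinite_super[rotated]) auto
  qed
qed

text \<open>With \<open>p = 1 - 2 * e\<close> this expresses that too few evaluations are spent to
  resolve a regret of order \<open>r n powr (- p)\<close>: the averaged noise has deviation of order
  \<open>1 / sqrt (s n)\<close>, which is at least of that order.\<close>

lemma eventually_sqrt_sample_le:
  assumes O: "(\<lambda>n. real (s n)) \<in> O[at_top](\<lambda>n. real (r n) powr \<beta>)" and p: "\<beta> \<le> 2 * p"
  obtains c where "0 \<le> c" "eventually (\<lambda>n. sqrt (real (s n)) \<le> c * real (r n) powr p) at_top"
proof -
  from O obtain c where c: "0 < c"
    and ev: "eventually (\<lambda>n. norm (real (s n)) \<le> c * norm (real (r n) powr \<beta>)) at_top"
    by (rule landau_o.bigE)
  from ev eventually_ge_at_top[of 1]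
  have "eventually (\<lambda>n. sqrt (real (s n)) \<le> sqrt c * real (r n) powr p) at_top"
  proof eventually_elim
    case (elim n)
    have "real (s n) \<le> c * real (r n) powr \<beta>"
      using elim by simp
    \<comment> \<open>Raising the exponent from \<open>\<beta>\<close> to \<open>2 * p\<close> is
      legitimate because \<open>r n \<ge> 1\<close>.\<close>
    also have "\<dots> \<le> c * real (r n) powr (2 * p)"
      using c p r_pos[of n] elim by (intro mult_left_mono powr_mono) auto
    also have "real (r n) powr (2 * p) = (real (r n) powr p)\<^sup>2"
      by (simp add: power2_eq_square flip: powr_add)
    finally have "sqrt (real (s n)) \<le> sqrt (c * (real (r n) powr p)\<^sup>2)"
      by simp
    then show ?case
      by (simp add: real_sqrt_mult)
  qed
  then show thesis
    using c that[of "sqrt c"] by simp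
qed

end

section \<open>From large noise differences to wrong selections\<close>

text \<open>The conclusion is split because the asymptotic assumption ranks the solvers only for
  large evaluation counts: choosing solver 2 is known to be wrong once \<open>r n\<close> is
  large.\<close>

theorem mainTheorem3:
  fixes P :: "'w measure"
    and D :: "(real ^ 'd) set"
    and N :: "real measure"
    and f :: "real ^ 'd \<Rightarrow> real \<Rightarrow> real"
    and xstar :: "real ^ 'd"
    and lag r s :: "nat \<Rightarrow> nat"
    and x :: "nat \<Rightarrow> nat \<Rightarrow> 'w \<Rightarrow> real ^ 'd"
    and noise :: "nat \<Rightarrow> nat \<Rightarrow> nat \<Rightarrow> 'w \<Rightarrow> real"
    and sel :: "nat \<Rightarrow> 'w \<Rightarrow> nat"
    and C1 C2 e \<beta> :: real
  assumes "nopa P D N f xstar 2 lag r s x noise sel"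
    and "\<And>n. 1 \<le> n \<Longrightarrow> lag (r n) = r n"
    and "N = std_normal_distribution"
    and "0 < e" and "e < 1 / 2" and "0 < C1" and "0 < C2"
    and "AE \<omega> in P.
           (\<lambda>m. simple_regret N f xstar x 1 m \<omega>) \<sim>[at_top] (\<lambda>m. C1 / real m powr (1 - e)) \<and>
           (\<lambda>m. simple_regret N f xstar x 2 m \<omega>) \<sim>[at_top] (\<lambda>m. C2 / real m powr (1 - 2 * e))"
    and "(\<lambda>n. real (s n)) \<in> O[at_top](\<lambda>n. real (r n) powr \<beta>)"
    and "\<beta> \<le> 2 - 4 * e"
  shows "AE \<omega> in P.
           infinite {n. 1 \<le> n \<and> sel n \<omega> = 2} \<and>
           (filterlim r at_top at_top \<longrightarrow>
             infinite {n. 1 \<le> n \<and> wrong_selection N f xstar x 2 r sel n \<omega>})"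
proof -
  interpret nopa P D N f xstar 2 lag r s x noise sel by (rule assms(1))
  let ?SR = "simple_regret N f xstar x"
  obtain c where c: "0 \<le> c"
    and s_le: "eventually (\<lambda>n. sqrt (real (s n)) \<le> c * real (r n) powr (1 - 2 * e)) at_top"
    by (rule eventually_sqrt_sample_le[OF assms(9), of "1 - 2 * e"]) (use assms(10) in auto)
  \<comment> \<open>All integer levels are placed in one almost sure event, because the constant
    \<open>B\<close> below, and with it the level required, depends on
    \<open>\<omega>\<close>.\<close>
  have "AE \<omega> in P. \<forall>a::nat. infinite {n. 1 \<le> n \<and> real a * sqrt (2 * real (s n))
      < (\<Sum>k=1..s n. noise n 1 k \<omega>) - (\<Sum>k=1..s n. noise n 2 k \<omega>)}"
    using AE_infinite_noise_exceed[OF refl assms(3)] by (simp add: AE_all_countable)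
  with assms(8) AE_space show ?thesis
  proof eventually_elim
    case (elim \<omega>)
    obtain B where B: "\<And>m. \<bar>?SR 2 m \<omega>\<bar> * real m powr (1 - 2 * e) \<le> B"
      using asymp_equiv_powr_imp_bounded[OF elim(1)[THEN conjunct2]] by blast
    obtain a :: nat where a: "c * B \<le> real a"
      using real_arch_simple by blast
    let ?E = "{n. 1 \<le> n \<and> real a * sqrt (2 * real (s n))
      < (\<Sum>k=1..s n. noise n 1 k \<omega>) - (\<Sum>k=1..s n. noise n 2 k \<omega>)}"
    from s_le obtain n0
      where n0: "\<And>n. n0 \<le> n \<Longrightarrow> sqrt (real (s n)) \<le> c * real (r n) powr (1 - 2 * e)"
      by (auto simp: eventually_at_top_linorder)
    have "sel n \<omega> = 2" if n: "n \<in> ?E" "n0 \<le> n" for n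
    proof (rule selects_second)
      \<comment> \<open>The factor \<open>s n\<close> is split into two square roots: one is
        absorbed by the decay of the regret, the other remains as the scale of the noise
        difference.\<close>
      have "sqrt (real (s n)) * ?SR 2 (r n) \<omega> \<le> sqrt (real (s n)) * \<bar>?SR 2 (r n) \<omega>\<bar>"
        by (intro mult_left_mono) auto
      also have "\<dots> \<le> (c * real (r n) powr (1 - 2 * e)) * \<bar>?SR 2 (r n) \<omega>\<bar>"
        using n0[OF n(2)] by (rule mult_right_mono) simp
      also have "\<dots> = c * (\<bar>?SR 2 (r n) \<omega>\<bar> * real (r n) powr (1 - 2 * e))"
        by simp
      also have "\<dots> \<le> c * B"
        using B[of "r n"] c by (rule mult_left_mono)
      also note a
      finally have "sqrt (real (s n)) * (sqrt (real (s n)) * ?SR 2 (r n) \<omega>) \<le> sqrt (real (s n)) * real a"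
        by (intro mult_left_mono) auto
      then have "real (s n) * ?SR 2 (r n) \<omega> \<le> real a * sqrt (real (s n))"
        by (simp only: mult.assoc[symmetric] real_sqrt_mult_self abs_of_nat mult.commute[of "real a"])
      \<comment> \<open>The factor 2 matches the deviation \<open>sqrt (2 * s n)\<close> of the
        noise difference.\<close>
      also have "\<dots> \<le> real a * sqrt (2 * real (s n))"
        by (intro mult_left_mono) auto
      finally show "real (s n) * ?SR 2 (r n) \<omega>
          < (\<Sum>k=1..s n. noise n 1 k \<omega>) - (\<Sum>k=1..s n. noise n 2 k \<omega>)"
        using n by simp
    qed (use n elim assms(2) in auto)
    then have "?E - {..<n0} \<subseteq> {n. 1 \<le> n \<and> sel n \<omega> = 2}"
      by auto
    moreover have "infinite (?E - {..<n0})"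
      using elim by (intro Diff_infinite_finite) auto
    ultimately have inf: "infinite {n. 1 \<le> n \<and> sel n \<omega> = 2}"
      by (rule infinite_super)
    have "infinite {n. 1 \<le> n \<and> wrong_selection N f xstar x 2 r sel n \<omega>}"
      if r: "filterlim r at_top at_top"
    proof -
      \<comment> \<open>Since \<open>e > 0\<close>, the exponent \<open>1 - e\<close> exceeds
        \<open>1 - 2 * e\<close>, so the regret of solver 1 decays faster.\<close>
      have "eventually (\<lambda>m. ?SR 1 m \<omega> < ?SR 2 m \<omega>) at_top"
        by (rule eventually_powr_asymp_less[OF elim(1)[THEN conjunct1] elim(1)[THEN conjunct2]])
          (use assms(4,7) in auto)
      then have "eventually (\<lambda>n. ?SR 1 (r n) \<omega> < ?SR 2 (r n) \<omega>) at_top"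
        using r by (rule eventually_compose_filterlim)
      then obtain n1 where n1: "\<And>n. n1 \<le> n \<Longrightarrow> ?SR 1 (r n) \<omega> < ?SR 2 (r n) \<omega>"
        by (auto simp: eventually_at_top_linorder)
      have "{n. 1 \<le> n \<and> sel n \<omega> = 2} - {..<n1}
          \<subseteq> {n. 1 \<le> n \<and> wrong_selection N f xstar x 2 r sel n \<omega>}"
        using n1 by (force simp: wrong_selection_def not_le)
      moreover have "infinite ({n. 1 \<le> n \<and> sel n \<omega> = 2} - {..<n1})"
        using inf by (intro Diff_infinite_finite) auto
      ultimately show ?thesis
        by (rule infinite_super)
    qed
    with inf show ?case by blast
  qed
qed

end
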